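(* Let $(\mathrm{P},\mathrm{P}_{LA})$ be either of the two pairs of optimization problems (GUTLCSCP, GUTLCSCP-LA) or (RUTLCSCP, RUTLCSCP-LA-RC) defined in the context, for any data as described there. Suppose $X_{LA}$ is an optimal solution of the linear approximate problem $\mathrm{P}_{LA}$, with objective value $F_{LA}(X_{LA})$, and $X$ is an optimal solution of the problem $\mathrm{P}$ with nonlinear constraints, with objective value $F(X)$. Then $$F_{LA}(X_{LA})\le F(X),$$ i.e. $F_{LA}(X_{LA})$ is a lower bound on the optimal objective value of $\mathrm{P}$. Moreover, if the nonlinear constraints of $\mathrm{P}$ are satisfied when (the $(y,z)$-part of) $X_{LA}$ is substituted into $\mathrm{P}$, then $F_{LA}(X_{LA})=F(X)$.
   Context: Data. $\mathcal I=\{1,\dots,m\}$ (demand nodes), $\mathcal J=\{1,\dots,n_1\}$ (potential y-facility sites), $\mathcal K=\{1,\dots,n_2\}$ (potential z-facility sites); real building costs $c^1_j$ ($j\in\mathcal J$) and $c^2_k$ ($k\in\mathcal K$); a level $\alpha\in(0,1)$. Decision variables $y\in\{0,1\}^{n_1}$, $z\in\{0,1\}^{n_2}$. In all four problems below the objective, to be minimized, is $\sum_{j\in\mathcal J}c^1_jy_j+\sum_{k\in\mathcal K}c^2_kz_k$; it is called $F$ for the nonlinear problems and $F_{LA}$ for the linear approximate problems. Linearization parameters. A finite list of pairs $(\beta_l,\gamma_l)$, $l=1,\dots,L$, with $\beta_l\in[0,1)$, $\gamma_l\in(0,1]$, $\beta_l+\gamma_l=1$. For each pair put $$\delta_l=\frac{2\gamma_l+\alpha\beta_l-\alpha\gamma_l-\sqrt{\alpha(4\beta_l\gamma_l+\alpha\beta_l^2+\alpha\gamma_l^2-2\alpha\beta_l\gamma_l)}}{2\gamma_l},\qquad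 R_l=\ln\left[\left(1-\frac{\alpha}{1-\delta_l}\right)^{\beta_l}\delta_l^{\gamma_l}\right],$$ with the convention $0^0=1$. GUTLCSCP (generalized uncertain two-level cooperative set covering problem). Given probabilities $p_{ij},q_{ik}\in(0,1]$ (that site $j$, respectively $k$, fails to cover node $i$; all these events are independent), minimize the objective over $y\in\{0,1\}^{n_1}$, $z\in\{0,1\}^{n_2}$ subject to the nonlinear constraints $$\Big(1-\prod_{j\in\mathcal J}p_{ij}^{y_j}\Big)\Big(1-\prod_{k\in\mathcal K}q_{ik}^{z_k}\Big)\ge\alpha\quad\text{for all } i\in\mathcal I.$$ GUTLCSCP-LA. With the same data, minimize the objective over $y\in\{0,1\}^{n_1}$, $z\in\{0,1\}^{n_2}$ subject to, for all $i\in\mathcal I$ and all $l=1,\dots,L$: $$\sum_{j\in\mathcal J}\ln(p_{ij})y_j\le\ln(1-\alpha),\qquad \sum_{k\in\mathcal K}\ln(q_{ik})z_k\le\ln(1-\alpha),$$ $$\beta_l\sum_{j\in\mathcal J}\ln(p_{ij})y_j+\gamma_l\sum_{k\in\mathcal K}\ln(q_{ik})z_k\le R_l.$$ RUTLCSCP (robust uncertain two-level cooperative set covering problem). Given nominal values $\bar p_{ij},\bar q_{ik}>0$, worst-case deviations $\hat p_{ij},\hat q_{ik}\ge0$ with $\bar p_{ij}+\hat p_{ij}\le1$, $\bar q_{ik}+\hat q_{ik}\le1$, and budgets $\Gamma_i\in\mathbb N_0$ ($i\in\mathcal I$), put $\mathcal C^1(y)=\{j\in\mathcal J: y_j=1\}$,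 $\mathcal C^2(z)=\{k\in\mathcal K: z_k=1\}$ and $$\beta^1_i(y,\Gamma_i)=\max_{\mathcal U_1\subseteq\mathcal C^1(y),\,|\mathcal U_1|\le\Gamma_i}\ \prod_{j\in\mathcal U_1}(\bar p_{ij}+\hat p_{ij})^{y_j}\prod_{j\in\mathcal J\setminus\mathcal U_1}\bar p_{ij}^{\,y_j},$$ $$\beta^2_i(z,\Gamma_i)=\max_{\mathcal U_2\subseteq\mathcal C^2(z),\,|\mathcal U_2|\le\Gamma_i}\ \prod_{k\in\mathcal U_2}(\bar q_{ik}+\hat q_{ik})^{z_k}\prod_{k\in\mathcal K\setminus\mathcal U_2}\bar q_{ik}^{\,z_k}.$$ Minimize the objective over $y\in\{0,1\}^{n_1}$, $z\in\{0,1\}^{n_2}$ subject to the nonlinear constraints $$[1-\beta^1_i(y,\Gamma_i)]\,[1-\beta^2_i(z,\Gamma_i)]\ge\alpha\quad\text{for all } i\in\mathcal I.$$ RUTLCSCP-LA-RC. With the same data as RUTLCSCP, minimize the objective over $y\in\{0,1\}^{n_1}$, $z\in\{0,1\}^{n_2}$ and real variables $\zeta^1_{ij}\ge0$, $\zeta^2_{ik}\ge0$, $\eta^1_i\ge0$, $\eta^2_i\ge0$ ($i\in\mathcal I,j\in\mathcal J,k\in\mathcal K$) subject to, writing $S^1_i=\sum_{j\in\mathcal J}\ln(\bar p_{ij})y_j+\sum_{j\in\mathcal J}\zeta^1_{ij}+\Gamma_i\eta^1_i$ and $S^2_i=\sum_{k\in\mathcal K}\ln(\bar q_{ik})z_k+\sum_{k\in\mathcal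 K}\zeta^2_{ik}+\Gamma_i\eta^2_i$, $$S^1_i\le\ln(1-\alpha),\qquad S^2_i\le\ln(1-\alpha),\qquad \beta_lS^1_i+\gamma_lS^2_i\le R_l,$$ $$\zeta^1_{ij}+\eta^1_i\ge(\ln(\bar p_{ij}+\hat p_{ij})-\ln(\bar p_{ij}))\,y_j,\qquad \zeta^2_{ik}+\eta^2_i\ge(\ln(\bar q_{ik}+\hat q_{ik})-\ln(\bar q_{ik}))\,z_k$$ for all $i\in\mathcal I$, $j\in\mathcal J$, $k\in\mathcal K$, $l=1,\dots,L$. *)

theory Defs
  imports "HOL-Analysis.Analysis"
begin

text \<open>
  A vector indexed by \<open>{1..n}\<close> is an extensional function on \<open>{1..n}\<close>; a matrix
  \<open>(a\<^sub>i\<^sub>j)\<close> of problem data is a function \<open>nat \<Rightarrow> nat \<Rightarrow> real\<close> of which only the entries in range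
  are used. Binary vectors take values in \<open>{0, 1} :: nat set\<close>.
\<close>

abbreviation binvecs :: "nat \<Rightarrow> (nat \<Rightarrow> nat) set" where
  "binvecs n \<equiv> {1..n} \<rightarrow>\<^sub>E {0, 1}"

definition cost ::
  "nat \<Rightarrow> nat \<Rightarrow> (nat \<Rightarrow> real) \<Rightarrow> (nat \<Rightarrow> real) \<Rightarrow> (nat \<Rightarrow> nat) \<Rightarrow> (nat \<Rightarrow> nat) \<Rightarrow> real" where
  "cost n1 n2 c1 c2 y z = (\<Sum>j=1..n1. c1 j * real (y j)) + (\<Sum>k=1..n2. c2 k * real (z k))"

text \<open>Real power with \<open>0\<^sup>0 = 1\<close>; note that \<open>0 powr 0 = 0\<close> in the library.\<close>

definition rpow :: "real \<Rightarrow> real \<Rightarrow> real" where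
  "rpow x a = (if x = 0 \<and> a = 0 then 1 else x powr a)"

definition lin_delta :: "real \<Rightarrow> real \<Rightarrow> real \<Rightarrow> real" where
  "lin_delta \<alpha> \<beta> \<gamma> =
     (2 * \<gamma> + \<alpha> * \<beta> - \<alpha> * \<gamma>
        - sqrt (\<alpha> * (4 * \<beta> * \<gamma> + \<alpha> * \<beta>\<^sup>2 + \<alpha> * \<gamma>\<^sup>2 - 2 * \<alpha> * \<beta> * \<gamma>))) / (2 * \<gamma>)"

definition lin_rhs :: "real \<Rightarrow> real \<Rightarrow> real \<Rightarrow> real" where
  "lin_rhs \<alpha> \<beta> \<gamma> =
     (let \<delta> = lin_delta \<alpha> \<beta> \<gamma> in ln (rpow (1 - \<alpha> / (1 - \<delta>)) \<beta> * rpow \<delta> \<gamma>))"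

definition GUTLCSCP_feasible ::
  "nat \<Rightarrow> nat \<Rightarrow> nat \<Rightarrow> real \<Rightarrow> (nat \<Rightarrow> nat \<Rightarrow> real) \<Rightarrow> (nat \<Rightarrow> nat \<Rightarrow> real)
     \<Rightarrow> ((nat \<Rightarrow> nat) \<times> (nat \<Rightarrow> nat)) set" where
  "GUTLCSCP_feasible m n1 n2 \<alpha> p q =
     {(y, z). y \<in> binvecs n1 \<and> z \<in> binvecs n2 \<and>
        (\<forall>i\<in>{1..m}. (1 - (\<Prod>j=1..n1. p i j ^ y j)) * (1 - (\<Prod>k=1..n2. q i k ^ z k)) \<ge> \<alpha>)}"

definition GUTLCSCP_LA_feasible ::
  "nat \<Rightarrow> nat \<Rightarrow> nat \<Rightarrow> real \<Rightarrow> nat \<Rightarrow> (nat \<Rightarrow> real) \<Rightarrow> (nat \<Rightarrow> real)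
     \<Rightarrow> (nat \<Rightarrow> nat \<Rightarrow> real) \<Rightarrow> (nat \<Rightarrow> nat \<Rightarrow> real) \<Rightarrow> ((nat \<Rightarrow> nat) \<times> (nat \<Rightarrow> nat)) set" where
  "GUTLCSCP_LA_feasible m n1 n2 \<alpha> L \<beta> \<gamma> p q =
     {(y, z). y \<in> binvecs n1 \<and> z \<in> binvecs n2 \<and>
        (\<forall>i\<in>{1..m}.
           (\<Sum>j=1..n1. ln (p i j) * real (y j)) \<le> ln (1 - \<alpha>) \<and>
           (\<Sum>k=1..n2. ln (q i k) * real (z k)) \<le> ln (1 - \<alpha>) \<and>
           (\<forall>l\<in>{1..L}.
              \<beta> l * (\<Sum>j=1..n1. ln (p i j) * real (y j))
                + \<gamma> l * (\<Sum>k=1..n2. ln (q i k) * real (z k)) \<le> lin_rhs \<alpha> (\<beta> l) (\<gamma> l)))}"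

text \<open>
  The worst-case failure probability at node \<open>i\<close>, with nominal values \<open>a\<close>, deviations \<open>d\<close> and
  budgets \<open>\<Gamma>\<close>. It serves both facility types: \<open>\<beta>\<^sup>1\<^sub>i(y, \<Gamma>\<^sub>i)\<close> and \<open>\<beta>\<^sup>2\<^sub>i(z, \<Gamma>\<^sub>i)\<close>.
\<close>

definition worst_case ::
  "nat \<Rightarrow> (nat \<Rightarrow> nat \<Rightarrow> real) \<Rightarrow> (nat \<Rightarrow> nat \<Rightarrow> real) \<Rightarrow> (nat \<Rightarrow> nat) \<Rightarrow> (nat \<Rightarrow> nat) \<Rightarrow> nat
     \<Rightarrow> real" where
  "worst_case n a d \<Gamma> x i =
     Max ((\<lambda>U. (\<Prod>j\<in>U. (a i j + d i j) ^ x j) * (\<Prod>j\<in>{1..n} - U. a i j ^ x j))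
            ` {U. U \<subseteq> {j\<in>{1..n}. x j = 1} \<and> card U \<le> \<Gamma> i})"

definition RUTLCSCP_feasible ::
  "nat \<Rightarrow> nat \<Rightarrow> nat \<Rightarrow> real
     \<Rightarrow> (nat \<Rightarrow> nat \<Rightarrow> real) \<Rightarrow> (nat \<Rightarrow> nat \<Rightarrow> real)
     \<Rightarrow> (nat \<Rightarrow> nat \<Rightarrow> real) \<Rightarrow> (nat \<Rightarrow> nat \<Rightarrow> real) \<Rightarrow> (nat \<Rightarrow> nat)
     \<Rightarrow> ((nat \<Rightarrow> nat) \<times> (nat \<Rightarrow> nat)) set" where
  "RUTLCSCP_feasible m n1 n2 \<alpha> p dp q dq \<Gamma> =
     {(y, z). y \<in> binvecs n1 \<and> z \<in> binvecs n2 \<and>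
        (\<forall>i\<in>{1..m}. (1 - worst_case n1 p dp \<Gamma> y i) * (1 - worst_case n2 q dq \<Gamma> z i) \<ge> \<alpha>)}"

definition rc_lhs ::
  "nat \<Rightarrow> (nat \<Rightarrow> nat \<Rightarrow> real) \<Rightarrow> (nat \<Rightarrow> nat) \<Rightarrow> (nat \<Rightarrow> nat) \<Rightarrow> (nat \<Rightarrow> nat \<Rightarrow> real) \<Rightarrow> (nat \<Rightarrow> real)
     \<Rightarrow> nat \<Rightarrow> real" where
  "rc_lhs n a \<Gamma> x \<zeta> \<eta> i =
     (\<Sum>j=1..n. ln (a i j) * real (x j)) + (\<Sum>j=1..n. \<zeta> i j) + real (\<Gamma> i) * \<eta> i"

definition RUTLCSCP_LA_RC_feasible ::
  "nat \<Rightarrow> nat \<Rightarrow> nat \<Rightarrow> real \<Rightarrow> nat \<Rightarrow> (nat \<Rightarrow> real) \<Rightarrow> (nat \<Rightarrow> real)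
     \<Rightarrow> (nat \<Rightarrow> nat \<Rightarrow> real) \<Rightarrow> (nat \<Rightarrow> nat \<Rightarrow> real)
     \<Rightarrow> (nat \<Rightarrow> nat \<Rightarrow> real) \<Rightarrow> (nat \<Rightarrow> nat \<Rightarrow> real) \<Rightarrow> (nat \<Rightarrow> nat)
     \<Rightarrow> ((nat \<Rightarrow> nat) \<times> (nat \<Rightarrow> nat)
           \<times> (nat \<Rightarrow> nat \<Rightarrow> real) \<times> (nat \<Rightarrow> nat \<Rightarrow> real) \<times> (nat \<Rightarrow> real) \<times> (nat \<Rightarrow> real)) set" where
  "RUTLCSCP_LA_RC_feasible m n1 n2 \<alpha> L \<beta> \<gamma> p dp q dq \<Gamma> =
     {(y, z, \<zeta>1, \<zeta>2, \<eta>1, \<eta>2). y \<in> binvecs n1 \<and> z \<in> binvecs n2 \<and>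
        \<zeta>1 \<in> {1..m} \<rightarrow>\<^sub>E {1..n1} \<rightarrow>\<^sub>E {0..} \<and> \<zeta>2 \<in> {1..m} \<rightarrow>\<^sub>E {1..n2} \<rightarrow>\<^sub>E {0..} \<and>
        \<eta>1 \<in> {1..m} \<rightarrow>\<^sub>E {0..} \<and> \<eta>2 \<in> {1..m} \<rightarrow>\<^sub>E {0..} \<and>
        (\<forall>i\<in>{1..m}.
           rc_lhs n1 p \<Gamma> y \<zeta>1 \<eta>1 i \<le> ln (1 - \<alpha>) \<and>
           rc_lhs n2 q \<Gamma> z \<zeta>2 \<eta>2 i \<le> ln (1 - \<alpha>) \<and>
           (\<forall>l\<in>{1..L}. \<beta> l * rc_lhs n1 p \<Gamma> y \<zeta>1 \<eta>1 i + \<gamma> l * rc_lhs n2 q \<Gamma> z \<zeta>2 \<eta>2 i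
                         \<le> lin_rhs \<alpha> (\<beta> l) (\<gamma> l)) \<and>
           (\<forall>j\<in>{1..n1}. \<zeta>1 i j + \<eta>1 i \<ge> (ln (p i j + dp i j) - ln (p i j)) * real (y j)) \<and>
           (\<forall>k\<in>{1..n2}. \<zeta>2 i k + \<eta>2 i \<ge> (ln (q i k + dq i k) - ln (q i k)) * real (z k)))}"

end

theory Submission
  imports Defs
begin

text \<open>
  The failure probabilities at a covered node are a point \<open>(P, Q)\<close> of the convex region
  \<open>(1 - P) * (1 - Q) \<ge> \<alpha>\<close>. The number \<open>\<delta>\<close> is chosen so that \<open>(1 - \<alpha> / (1 - \<delta>), \<delta>)\<close> is
  the boundary point at which \<open>\<beta> ln P + \<gamma> ln Q\<close> is stationary; by concavity of \<open>ln\<close> it is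
  the maximum over the region, so each linear constraint is a valid cut. In the robust problem,
  the logarithm of the inner maximum adds the \<open>\<Gamma>\<close> largest weights to the nominal
  value, and \<open>(\<zeta>, \<eta>)\<close> is recovered as its linear programming dual solution, with
  \<open>\<eta>\<close> the smallest selected weight.
\<close>

section \<open>The tangency point and the validity of the linear cuts\<close>

text \<open>Along the boundary \<open>P = 1 - \<alpha> / (1 - \<delta>)\<close>,
  \<open>Q = \<delta>\<close>, setting the derivative of \<open>\<beta> ln P + \<gamma> ln Q\<close>
  to zero gives the first equation. It is a quadratic in \<delta> with root sum
  \<open>b / \<gamma>\<close> and root product \<open>1 - \<alpha>\<close>, both positive, and
  \<open>lin_delta\<close> is its smaller root.\<close>

lemma lin_delta_props:
  assumes "0 < \<alpha>" "\<alpha> < 1" "0 \<le> \<beta>" "0 < \<gamma>"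
  defines "\<delta> \<equiv> lin_delta \<alpha> \<beta> \<gamma>"
  shows lin_delta_stationary: "\<gamma> * (1 - \<delta>) * (1 - \<delta> - \<alpha>) = \<alpha> * \<beta> * \<delta>"
    and lin_delta_pos: "0 < \<delta>"
    and lin_delta_le: "\<delta> \<le> 1 - \<alpha>"
proof -
  define b where "b = 2 * \<gamma> + \<alpha> * \<beta> - \<alpha> * \<gamma>"
  define D where "D = \<alpha> * (4 * \<beta> * \<gamma> + \<alpha> * \<beta>\<^sup>2 + \<alpha> * \<gamma>\<^sup>2 - 2 * \<alpha> * \<beta> * \<gamma>)"
  define s where "s = sqrt D"
  have D: "D = \<alpha> * (4 * \<beta> * \<gamma> + \<alpha> * (\<beta> - \<gamma>)\<^sup>2)"
    by (simp add: D_def power2_eq_square algebra_simps)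
  have D0: "0 \<le> D"
    using assms by (simp add: D)
  \<comment> \<open>\<open>D\<close> is the discriminant of \<open>\<gamma> * \<delta>\<^sup>2 - b *
    \<delta> + \<gamma> * (1 - \<alpha>)\<close>.\<close>
  have s2: "s\<^sup>2 = b\<^sup>2 - 4 * \<gamma>\<^sup>2 * (1 - \<alpha>)"
    using D0 by (simp add: s_def, simp add: D_def b_def power2_eq_square algebra_simps)
  have \<delta>: "2 * \<gamma> * \<delta> = b - s"
    using \<open>0 < \<gamma>\<close> by (simp add: \<delta>_def lin_delta_def b_def s_def D_def)
  have s_eq: "s = b - 2 * \<gamma> * \<delta>"
    using \<delta> by simp
  have "4 * \<gamma> * (\<gamma> * (1 - \<delta>) * (1 - \<delta> - \<alpha>) - \<alpha> * \<beta> * \<delta>)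
      = s\<^sup>2 - (b\<^sup>2 - 4 * \<gamma>\<^sup>2 * (1 - \<alpha>))"
    unfolding s_eq b_def by (simp add: power2_eq_square algebra_simps)
  then show "\<gamma> * (1 - \<delta>) * (1 - \<delta> - \<alpha>) = \<alpha> * \<beta> * \<delta>"
    using s2 \<open>0 < \<gamma>\<close> by simp
  have "\<alpha> * \<gamma> < \<gamma>" "0 \<le> \<alpha> * \<beta>"
    using assms by simp_all
  then have "0 < b"
    using \<open>0 < \<gamma>\<close> unfolding b_def by linarith
  moreover have "s\<^sup>2 < b\<^sup>2"
    using s2 assms by simp
  ultimately have "s < b"
    using power2_less_imp_less by fastforce
  then have "0 < 2 * \<gamma> * \<delta>"
    using \<delta> by simp
  then show "0 < \<delta>"
    using \<open>0 < \<gamma>\<close> by (simp add: zero_less_mult_iff)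
  \<comment> \<open>Since \<open>b - \<alpha> * (\<beta> + \<gamma>) = 2 * \<gamma> * (1 -
    \<alpha>)\<close>, the bound on \<delta> amounts to
    \<open>\<alpha> * (\<beta> + \<gamma>) \<le> s\<close>.\<close>
  have "D - (\<alpha> * (\<beta> + \<gamma>))\<^sup>2 = 4 * \<alpha> * (1 - \<alpha>) * (\<beta> * \<gamma>)"
    by (simp add: D_def power2_eq_square algebra_simps)
  also have "\<dots> \<ge> 0"
    using assms by simp
  finally have "(\<alpha> * (\<beta> + \<gamma>))\<^sup>2 \<le> D" by simp
  then have "\<alpha> * (\<beta> + \<gamma>) \<le> s"
    by (simp add: s_def real_le_rsqrt)
  then have "2 * \<gamma> * \<delta> \<le> 2 * \<gamma> * (1 - \<alpha>)"
    using \<delta> by (simp add: b_def algebra_simps)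
  then show "\<delta> \<le> 1 - \<alpha>"
    using \<open>0 < \<gamma>\<close> by simp
qed

text \<open>The factor \<open>1 - P\<close> is at most 1, so the other facility type alone must
  reach level \<alpha>. With the roles of \<open>P\<close> and \<open>Q\<close> exchanged, this
  yields both separate constraints with right-hand side \<open>ln (1 - \<alpha>)\<close>.\<close>

lemma coverage_le:
  fixes \<alpha> P Q :: real
  assumes "0 \<le> P" "Q \<le> 1" "\<alpha> \<le> (1 - P) * (1 - Q)"
  shows "Q \<le> 1 - \<alpha>"
proof -
  have "(1 - P) * (1 - Q) \<le> 1 * (1 - Q)"
    using assms by (intro mult_right_mono) auto
  then show ?thesis
    using assms by simp
qed

text \<open>Two tangent estimates at the stationary boundary point are combined: the region lies on
  one side of the tangent to the hyperbola there, and \<open>ln\<close> lies below its own tangents.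
  Stationarity makes the two linear forms proportional.\<close>

lemma lin_rhs_bound:
  assumes "0 < \<alpha>" "\<alpha> < 1" "0 \<le> \<beta>" "0 < \<gamma>" "\<beta> + \<gamma> = 1"
    and "0 < P" "P \<le> 1" "0 < Q" "Q \<le> 1"
    and cov: "\<alpha> \<le> (1 - P) * (1 - Q)"
  shows "\<beta> * ln P + \<gamma> * ln Q \<le> lin_rhs \<alpha> \<beta> \<gamma>"
\<comment> \<open>Here \<open>\<gamma> = 1\<close> and the tangency point degenerates to
  \<open>(0, 1 - \<alpha>)\<close>. The convention \<open>0^0 = 1\<close> in \<open>rpow\<close>
  removes the first factor, leaving the separate bound on \<open>Q\<close>.\<close>
proof (cases "\<beta> = 0")
  case True
  have "lin_delta \<alpha> 0 1 = 1 - \<alpha>"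
    using assms by (simp add: lin_delta_def power2_eq_square)
  then have "lin_rhs \<alpha> \<beta> \<gamma> = ln (1 - \<alpha>)"
    using True assms by (simp add: lin_rhs_def rpow_def)
  then show ?thesis
    using True assms coverage_le[of P Q \<alpha>] by simp
next
  case False
  with assms have \<beta>: "0 < \<beta>" by simp
  define \<delta> where "\<delta> = lin_delta \<alpha> \<beta> \<gamma>"
  define u0 where "u0 = \<alpha> / (1 - \<delta>)"
  define a where "a = 1 - u0"
  have stat: "\<gamma> * (1 - \<delta>) * (1 - \<delta> - \<alpha>) = \<alpha> * \<beta> * \<delta>" and \<delta>0: "0 < \<delta>" and "\<delta> \<le> 1 - \<alpha>"
    using lin_delta_props[OF assms(1-4)] by (simp_all add: \<delta>_def)
  \<comment> \<open>At \<open>\<delta> = 1 - \<alpha>\<close> the left side of \<open>stat\<close>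
    vanishes while the right side is positive. Strictness makes \<open>a\<close> positive, so that
    \<open>ln a\<close> is meaningful.\<close>
  moreover have "\<delta> \<noteq> 1 - \<alpha>"
    using stat \<beta> \<delta>0 \<open>0 < \<alpha>\<close> by auto
  ultimately have \<delta>1: "\<delta> < 1 - \<alpha>" by simp
  then have v0: "0 < 1 - \<delta>"
    using \<open>0 < \<alpha>\<close> by simp
  have u0v0: "u0 * (1 - \<delta>) = \<alpha>"
    using v0 by (simp add: u0_def)
  have u0: "0 < u0"
    using v0 \<open>0 < \<alpha>\<close> by (simp add: u0_def)
  have a0: "0 < a"
    using v0 \<delta>1 by (simp add: a_def u0_def)
  have a_eq: "(1 - \<delta>) * a = 1 - \<delta> - \<alpha>"
    using u0v0 by (simp add: a_def algebra_simps)
  have "(1 - \<delta>) * (\<gamma> * (1 - \<delta>) * a) = \<gamma> * (1 - \<delta>) * (1 - \<delta> - \<alpha>)"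
    by (simp add: mult_ac flip: a_eq)
  also have "\<dots> = (1 - \<delta>) * (u0 * \<beta> * \<delta>)"
    using stat by (simp add: mult_ac flip: u0v0)
  finally have "\<gamma> * (1 - \<delta>) * a = u0 * \<beta> * \<delta>"
    using v0 by simp
  \<comment> \<open>\<open>(\<beta> / a, \<gamma> / \<delta>)\<close> is a multiple of the normal \<open>(1 - \<delta>, u0)\<close> of the region's boundary
    at \<open>(a, \<delta>)\<close>.\<close>
  then have normal: "\<beta> / a = \<gamma> / (\<delta> * u0) * (1 - \<delta>)"
    using a0 \<delta>0 u0 by (simp add: field_simps)
  \<comment> \<open>AM-GM for the two summands on the right: by \<open>cov\<close> their product is
    at least \<open>\<alpha> * u0 * (1 - \<delta>) = (u0 * (1 - \<delta>))\<^sup>2\<close>. The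
    result is the tangent half-plane at \<open>(a, \<delta>)\<close>.\<close>
  have "2 * u0 * (1 - \<delta>) \<le> (1 - P) * (1 - \<delta>) + (1 - Q) * u0"
  proof (rule power2_le_imp_le)
    have "(2 * u0 * (1 - \<delta>))\<^sup>2 = 4 * (u0 * (1 - \<delta>)) * \<alpha>"
      by (simp add: power2_eq_square algebra_simps flip: u0v0)
    also have "\<dots> \<le> 4 * (u0 * (1 - \<delta>)) * ((1 - P) * (1 - Q))"
      using cov u0 v0 by (intro mult_left_mono) auto
    also have "\<dots> = ((1 - P) * (1 - \<delta>) + (1 - Q) * u0)\<^sup>2
        - ((1 - P) * (1 - \<delta>) - (1 - Q) * u0)\<^sup>2"
      by (simp add: power2_eq_square algebra_simps)
    also have "\<dots> \<le> ((1 - P) * (1 - \<delta>) + (1 - Q) * u0)\<^sup>2"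
      by simp
    finally show "(2 * u0 * (1 - \<delta>))\<^sup>2 \<le> ((1 - P) * (1 - \<delta>) + (1 - Q) * u0)\<^sup>2" .
    show "0 \<le> (1 - P) * (1 - \<delta>) + (1 - Q) * u0"
      using assms v0 u0 by simp
  qed
  then have "(1 - \<delta>) * (P - a) + u0 * (Q - \<delta>) \<le> 0"
    by (simp add: a_def algebra_simps)
  then have "\<gamma> / (\<delta> * u0) * ((1 - \<delta>) * (P - a) + u0 * (Q - \<delta>)) \<le> 0"
    using \<open>0 < \<gamma>\<close> \<delta>0 u0 by (intro mult_nonneg_nonpos) auto
  also have "\<gamma> / (\<delta> * u0) * ((1 - \<delta>) * (P - a) + u0 * (Q - \<delta>))
      = \<beta> / a * (P - a) + \<gamma> / \<delta> * (Q - \<delta>)"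
    unfolding normal using u0 by (simp add: distrib_left)
  also have "\<dots> = \<beta> * (P / a - 1) + \<gamma> * (Q / \<delta> - 1)"
    using a0 \<delta>0 by (simp add: field_simps)
  finally have tangent: "\<beta> * (P / a - 1) + \<gamma> * (Q / \<delta> - 1) \<le> 0" .
  \<comment> \<open>\<open>ln t \<le> t - 1\<close> at \<open>t = P / a\<close> and
    \<open>t = Q / \<delta>\<close>; both are equalities at the tangency point.\<close>
  have "\<beta> * ln (P / a) + \<gamma> * ln (Q / \<delta>) \<le> \<beta> * (P / a - 1) + \<gamma> * (Q / \<delta> - 1)"
    using assms a0 \<delta>0 by (intro add_mono mult_left_mono ln_le_minus_one) auto
  with tangent have "\<beta> * ln P + \<gamma> * ln Q \<le> \<beta> * ln a + \<gamma> * ln \<delta>"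
    using assms a0 \<delta>0 by (simp add: ln_div algebra_simps)
  also have "\<dots> = lin_rhs \<alpha> \<beta> \<gamma>"
    using a0 \<delta>0 by (simp add: lin_rhs_def rpow_def flip: \<delta>_def u0_def a_def,
        simp add: ln_mult ln_powr)
  finally show ?thesis .
qed

section \<open>Products of probabilities and their logarithms\<close>

lemma prod_power_pos_le_1:
  fixes a :: "nat \<Rightarrow> real"
  assumes "\<And>j. j \<in> A \<Longrightarrow> 0 < a j \<and> a j \<le> 1"
  shows "0 < (\<Prod>j\<in>A. a j ^ x j)" "(\<Prod>j\<in>A. a j ^ x j) \<le> 1"
  using assms by (auto intro!: prod_pos prod_le_1 power_le_one simp: less_imp_le)

lemma ln_prod_power:
  fixes a :: "nat \<Rightarrow> real"
  assumes "finite A" "\<And>j. j \<in> A \<Longrightarrow> 0 < a j"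
  shows "ln (\<Prod>j\<in>A. a j ^ x j) = (\<Sum>j\<in>A. ln (a j) * real (x j))"
proof -
  have "ln (\<Prod>j\<in>A. a j ^ x j) = (\<Sum>j\<in>A. ln (a j ^ x j))"
    using assms by (intro ln_prod) force+
  also have "\<dots> = (\<Sum>j\<in>A. ln (a j) * real (x j))"
    using assms(2) by (intro sum.cong) (simp_all add: ln_realpow mult.commute)
  finally show ?thesis .
qed

section \<open>Selecting the largest weights, and the linear programming dual\<close>

text \<open>Greedy choice: a heaviest element outside the current set joins it, and by the induction
  hypothesis it is no heavier than those already chosen.\<close>

lemma ex_top_subset:
  fixes w :: "'a \<Rightarrow> 'b :: linorder"
  assumes "finite A" "k \<le> card A"
  shows "\<exists>U\<subseteq>A. card U = k \<and> (\<forall>i\<in>U. \<forall>j\<in>A - U. w j \<le> w i)"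
  using assms(2)
proof (induction k)
  case 0
  show ?case by (intro exI[of _ "{}"]) simp
next
  case (Suc k)
  then obtain U where U: "U \<subseteq> A" "card U = k" "\<forall>i\<in>U. \<forall>j\<in>A - U. w j \<le> w i"
    by auto
  have fin: "finite U"
    using U(1) assms(1) finite_subset by blast
  have "A - U \<noteq> {}"
    using U fin Suc.prems by auto
  then have "Max (w ` (A - U)) \<in> w ` (A - U)"
    using assms(1) by (intro Max_in) auto
  then obtain a where a: "a \<in> A - U" "w a = Max (w ` (A - U))"
    by auto
  then have a_max: "\<forall>j\<in>A - U. w j \<le> w a"
    using assms(1) by simp
  have "card (insert a U) = Suc k"
    using a U fin by simp
  then show ?case
    using U a(1) a_max by (intro exI[of _ "insert a U"]) auto
qed

text \<open>Strong duality for choosing at most \<open>k\<close> weights: \<theta> prices the budget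
  and \<open>max 0 (w j - \<theta>)\<close> prices the bound on each single choice. If the budget
  exceeds or equals \<open>card A\<close>, everything is taken at price 0.\<close>

lemma ex_top_sum_dual:
  fixes w :: "'a \<Rightarrow> real"
  assumes "finite A" and w0: "\<And>j. j \<in> A \<Longrightarrow> 0 \<le> w j"
  shows "\<exists>U\<subseteq>A. card U \<le> k \<and> (\<exists>\<theta>\<ge>0. (\<Sum>j\<in>A. max 0 (w j - \<theta>)) + real k * \<theta> = sum w U)"
proof (cases "card A \<le> k")
  case True
  have "(\<Sum>j\<in>A. max 0 (w j - 0)) = sum w A"
    using w0 by (intro sum.cong) auto
  then show ?thesis
    using True by (intro exI[of _ A] conjI exI[of _ 0]) auto
next
  case False
  then obtain U where U: "U \<subseteq> A" "card U = k" "\<forall>i\<in>U. \<forall>j\<in>A - U. w j \<le> w i"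
    using ex_top_subset[OF assms(1), of k w] by auto
  have fin: "finite U"
    using U(1) assms(1) finite_subset by blast
  \<comment> \<open>A threshold separates chosen from unchosen weights. For empty \<open>U\<close>
    any nonnegative upper bound of the weights serves, such as their sum; otherwise the least chosen
    weight does.\<close>
  have "\<exists>\<theta>\<ge>0. (\<forall>i\<in>U. \<theta> \<le> w i) \<and> (\<forall>j\<in>A - U. w j \<le> \<theta>)"
  proof (cases "U = {}")
    case True
    then show ?thesis
      using assms by (intro exI[of _ "sum w A"]) (auto intro: sum_nonneg member_le_sum)
  next
    case False
    have "Min (w ` U) \<in> w ` U"
      using False fin by simp
    then show ?thesis
      using U w0 fin by (intro exI[of _ "Min (w ` U)"]) auto
  qed
  then obtain \<theta> where \<theta>: "0 \<le> \<theta>" "\<And>i. i \<in> U \<Longrightarrow> \<theta> \<le> w i" "\<And>j. j \<in> A - U \<Longrightarrow> w j \<le> \<theta>"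
    by blast
  \<comment> \<open>Unchosen elements contribute 0, and each of the \<open>k\<close> chosen ones
    gives up exactly one \<theta>, which the budget term restores.\<close>
  have "(\<Sum>j\<in>A. max 0 (w j - \<theta>)) = (\<Sum>j\<in>U. max 0 (w j - \<theta>))"
    using U(1) \<theta>(3) assms(1) by (intro sum.mono_neutral_right) auto
  also have "\<dots> = (\<Sum>j\<in>U. w j - \<theta>)"
    using \<theta>(2) by (intro sum.cong) (auto simp: max_absorb2)
  also have "\<dots> = sum w U - real k * \<theta>"
    using U(2) by (simp add: sum_subtractf)
  finally have "(\<Sum>j\<in>A. max 0 (w j - \<theta>)) + real k * \<theta> = sum w U"
    by simp
  then show ?thesis
    using U(1,2) \<theta>(1) by (intro exI[of _ U] conjI exI[of _ \<theta>]) simp_all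
qed

section \<open>The robust counterpart at a single node and at all nodes\<close>

text \<open>In logarithms, deviating on \<open>U\<close> adds \<open>sum w U\<close> to the nominal
  value. Evaluating the maximum at the top set \<open>U\<close> bounds it below by a value that the
  dual variables attain exactly.\<close>

lemma worst_case_dual:
  assumes x: "x \<in> binvecs n"
    and ad: "\<And>j. j \<in> {1..n} \<Longrightarrow> 0 < a i j \<and> 0 \<le> d i j \<and> a i j + d i j \<le> 1"
  shows worst_case_pos: "0 < worst_case n a d \<Gamma> x i"
    and worst_case_le_1: "worst_case n a d \<Gamma> x i \<le> 1"
    and ex_dual: "\<exists>\<theta>\<ge>0. \<exists>\<zeta>. (\<forall>j. 0 \<le> \<zeta> j) \<and>
      (\<forall>j\<in>{1..n}. (ln (a i j + d i j) - ln (a i j)) * real (x j) \<le> \<zeta> j + \<theta>) \<and>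
      (\<Sum>j=1..n. ln (a i j) * real (x j)) + (\<Sum>j=1..n. \<zeta> j) + real (\<Gamma> i) * \<theta>
        \<le> ln (worst_case n a d \<Gamma> x i)"
proof -
  define F where "F U = (\<Prod>j\<in>U. (a i j + d i j) ^ x j) * (\<Prod>j\<in>{1..n} - U. a i j ^ x j)" for U
  define C where "C = {j\<in>{1..n}. x j = 1}"
  define \<U> where "\<U> = {U. U \<subseteq> C \<and> card U \<le> \<Gamma> i}"
  have wc: "worst_case n a d \<Gamma> x i = Max (F ` \<U>)"
    by (simp add: worst_case_def F_def \<U>_def C_def)
  have C: "C \<subseteq> {1..n}" "finite C"
    by (auto simp: C_def)
  have x0: "x j = 0" if "j \<in> {1..n} - C" for j
    using x that by (auto simp: C_def PiE_iff)
  have fin: "finite \<U>"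
    using C by (simp add: \<U>_def)
  have "{} \<in> \<U>"
    by (simp add: \<U>_def)
  then have ne: "F ` \<U> \<noteq> {}" by blast
  have apos: "0 < a i j" "a i j \<le> 1" "0 < a i j + d i j" "a i j + d i j \<le> 1" if "j \<in> {1..n}" for j
    using ad[OF that] by auto
  have F_bounds: "0 < F U \<and> F U \<le> 1" if "U \<subseteq> {1..n}" for U
  proof -
    have 1: "0 < (\<Prod>j\<in>U. (a i j + d i j) ^ x j)" "(\<Prod>j\<in>U. (a i j + d i j) ^ x j) \<le> 1"
      using that apos by (intro prod_power_pos_le_1; auto)+
    have 2: "0 < (\<Prod>j\<in>{1..n} - U. a i j ^ x j)" "(\<Prod>j\<in>{1..n} - U. a i j ^ x j) \<le> 1"
      using apos by (intro prod_power_pos_le_1; auto)+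
    show ?thesis
      unfolding F_def using 1 2 by (auto intro: mult_le_one)
  qed
  have "worst_case n a d \<Gamma> x i \<in> F ` \<U>"
    unfolding wc using fin ne by simp
  then show "0 < worst_case n a d \<Gamma> x i" "worst_case n a d \<Gamma> x i \<le> 1"
    using F_bounds C(1) by (force simp: \<U>_def)+
  define w where "w j = ln (a i j + d i j) - ln (a i j)" for j
  have w0: "0 \<le> w j" if "j \<in> C" for j
    using ad[of j] that by (simp add: C_def w_def)
  obtain U \<theta> where U: "U \<subseteq> C" "card U \<le> \<Gamma> i" "0 \<le> \<theta>"
    "(\<Sum>j\<in>C. max 0 (w j - \<theta>)) + real (\<Gamma> i) * \<theta> = sum w U"
    using ex_top_sum_dual[of C w "\<Gamma> i"] C(2) w0 by (elim meta_impE exE conjE) simp_all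
  \<comment> \<open>At unopened sites \<open>x j = 0\<close>, so \<open>\<theta> \<ge> 0\<close>
    forces \<open>\<zeta> j = 0\<close> and the sum reduces to \<open>C\<close>.\<close>
  define \<zeta> where "\<zeta> j = max 0 (w j * real (x j) - \<theta>)" for j
  have "(\<Sum>j=1..n. \<zeta> j) = (\<Sum>j\<in>C. \<zeta> j)"
    using C(1) x0 U(3) by (intro sum.mono_neutral_right) (auto simp: \<zeta>_def)
  also have "\<dots> = (\<Sum>j\<in>C. max 0 (w j - \<theta>))"
    by (intro sum.cong) (auto simp: \<zeta>_def C_def)
  finally have sum_\<zeta>: "(\<Sum>j=1..n. \<zeta> j) + real (\<Gamma> i) * \<theta> = sum w U"
    using U(4) by simp
  have Un: "U \<subseteq> {1..n}"
    using U(1) C(1) by blast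
  then have finU: "finite U"
    using finite_subset by blast
  have "ln (F U) = (\<Sum>j\<in>U. ln (a i j + d i j) * real (x j))
      + (\<Sum>j\<in>{1..n} - U. ln (a i j) * real (x j))"
  proof -
    have "0 < (\<Prod>j\<in>U. (a i j + d i j) ^ x j)" "0 < (\<Prod>j\<in>{1..n} - U. a i j ^ x j)"
      using Un apos by (intro prod_power_pos_le_1; auto)+
    then have "ln (F U) = ln (\<Prod>j\<in>U. (a i j + d i j) ^ x j) + ln (\<Prod>j\<in>{1..n} - U. a i j ^ x j)"
      unfolding F_def by (rule ln_mult_pos)
    then show ?thesis
      using Un finU apos by (subst (asm) (1 2) ln_prod_power) auto
  qed
  \<comment> \<open>All sites of \<open>U\<close> are open, so each exponent is 1 and the deviation
    adds exactly \<open>w j\<close>.\<close>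
  also have "(\<Sum>j\<in>U. ln (a i j + d i j) * real (x j)) = (\<Sum>j\<in>U. ln (a i j) * real (x j)) + sum w U"
    using U(1) by (auto simp: C_def w_def simp flip: sum.distrib intro!: sum.cong)
  finally have "ln (F U) = (\<Sum>j=1..n. ln (a i j) * real (x j)) + sum w U"
    using sum.subset_diff[OF Un, of "\<lambda>j. ln (a i j) * real (x j)"] by simp
  moreover have "F U \<le> worst_case n a d \<Gamma> x i"
    unfolding wc using fin U by (intro Max_ge) (auto simp: \<U>_def)
  then have "ln (F U) \<le> ln (worst_case n a d \<Gamma> x i)"
    using F_bounds[OF Un] by simp
  ultimately have "(\<Sum>j=1..n. ln (a i j) * real (x j)) + (\<Sum>j=1..n. \<zeta> j) + real (\<Gamma> i) * \<theta>
      \<le> ln (worst_case n a d \<Gamma> x i)"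
    using sum_\<zeta> by simp
  moreover have "\<forall>j. 0 \<le> \<zeta> j" "\<forall>j\<in>{1..n}. w j * real (x j) \<le> \<zeta> j + \<theta>"
    by (auto simp: \<zeta>_def)
  ultimately show "\<exists>\<theta>\<ge>0. \<exists>\<zeta>. (\<forall>j. 0 \<le> \<zeta> j) \<and>
      (\<forall>j\<in>{1..n}. (ln (a i j + d i j) - ln (a i j)) * real (x j) \<le> \<zeta> j + \<theta>) \<and>
      (\<Sum>j=1..n. ln (a i j) * real (x j)) + (\<Sum>j=1..n. \<zeta> j) + real (\<Gamma> i) * \<theta>
        \<le> ln (worst_case n a d \<Gamma> x i)"
    using U(3) unfolding w_def by blast
qed

lemma ex_rc_variables:
  assumes x: "x \<in> binvecs n"
    and ad: "\<And>i j. i \<in> {1..m} \<Longrightarrow> j \<in> {1..n} \<Longrightarrow> 0 < a i j \<and> 0 \<le> d i j \<and> a i j + d i j \<le> 1"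
  shows "\<exists>\<zeta> \<eta>. \<zeta> \<in> {1..m} \<rightarrow>\<^sub>E {1..n} \<rightarrow>\<^sub>E {0..} \<and> \<eta> \<in> {1..m} \<rightarrow>\<^sub>E {0..} \<and>
    (\<forall>i\<in>{1..m}. rc_lhs n a \<Gamma> x \<zeta> \<eta> i \<le> ln (worst_case n a d \<Gamma> x i) \<and>
      (\<forall>j\<in>{1..n}. \<zeta> i j + \<eta> i \<ge> (ln (a i j + d i j) - ln (a i j)) * real (x j)))"
proof -
  define R where "R i \<theta> \<zeta> \<longleftrightarrow> 0 \<le> \<theta> \<and> (\<forall>j. 0 \<le> \<zeta> j) \<and>
      (\<forall>j\<in>{1..n}. (ln (a i j + d i j) - ln (a i j)) * real (x j) \<le> \<zeta> j + \<theta>) \<and>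
      (\<Sum>j=1..n. ln (a i j) * real (x j)) + (\<Sum>j=1..n. \<zeta> j) + real (\<Gamma> i) * \<theta>
        \<le> ln (worst_case n a d \<Gamma> x i)" for i \<theta> \<zeta>
  have "\<exists>\<theta> \<zeta>. R i \<theta> \<zeta>" if "i \<in> {1..m}" for i
    unfolding R_def
    using ex_dual[where i = i and a = a and d = d and \<Gamma> = \<Gamma>, OF x ad[OF that]] by blast
  then obtain \<eta> \<zeta> where *: "\<And>i. i \<in> {1..m} \<Longrightarrow> R i (\<eta> i) (\<zeta> i)"
    by metis
  show ?thesis
    \<comment> \<open>The pointwise choices are restricted to the index ranges because the feasible
      set consists of extensional functions.\<close>
    using * by (intro exI[of _ "\<lambda>i\<in>{1..m}. \<lambda>j\<in>{1..n}. \<zeta> i j"] exI[of _ "\<lambda>i\<in>{1..m}. \<eta> i"])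
      (auto simp: R_def rc_lhs_def PiE_iff)
qed

section \<open>The linear problems as relaxations of the nonlinear ones\<close>

lemma GUTLCSCP_feasible_subset_LA:
  assumes \<alpha>: "0 < \<alpha>" "\<alpha> < 1"
    and \<beta>\<gamma>: "\<And>l. l \<in> {1..L} \<Longrightarrow> 0 \<le> \<beta> l \<and> 0 < \<gamma> l \<and> \<beta> l + \<gamma> l = 1"
    and p: "\<forall>i\<in>{1..m}. \<forall>j\<in>{1..n1}. 0 < p i j \<and> p i j \<le> 1"
    and q: "\<forall>i\<in>{1..m}. \<forall>k\<in>{1..n2}. 0 < q i k \<and> q i k \<le> 1"
  shows "GUTLCSCP_feasible m n1 n2 \<alpha> p q \<subseteq> GUTLCSCP_LA_feasible m n1 n2 \<alpha> L \<beta> \<gamma> p q"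
proof clarify
  fix y z assume X: "(y, z) \<in> GUTLCSCP_feasible m n1 n2 \<alpha> p q"
  have "(\<Sum>j=1..n1. ln (p i j) * real (y j)) \<le> ln (1 - \<alpha>) \<and>
      (\<Sum>k=1..n2. ln (q i k) * real (z k)) \<le> ln (1 - \<alpha>) \<and>
      (\<forall>l\<in>{1..L}. \<beta> l * (\<Sum>j=1..n1. ln (p i j) * real (y j))
        + \<gamma> l * (\<Sum>k=1..n2. ln (q i k) * real (z k)) \<le> lin_rhs \<alpha> (\<beta> l) (\<gamma> l))"
    if i: "i \<in> {1..m}" for i
  proof -
    let ?P = "\<Prod>j=1..n1. p i j ^ y j" and ?Q = "\<Prod>k=1..n2. q i k ^ z k"
    have P: "0 < ?P" "?P \<le> 1" and Q: "0 < ?Q" "?Q \<le> 1"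
      using p q i by (intro prod_power_pos_le_1; auto)+
    have cov: "\<alpha> \<le> (1 - ?P) * (1 - ?Q)"
      using X i by (simp add: GUTLCSCP_feasible_def)
    then have "?Q \<le> 1 - \<alpha>" "?P \<le> 1 - \<alpha>"
      using P Q coverage_le[of ?P ?Q \<alpha>] coverage_le[of ?Q ?P \<alpha>] by (simp_all add: mult.commute)
    then have "ln ?P \<le> ln (1 - \<alpha>)" "ln ?Q \<le> ln (1 - \<alpha>)"
      using P Q by simp_all
    moreover have "\<forall>l\<in>{1..L}. \<beta> l * ln ?P + \<gamma> l * ln ?Q \<le> lin_rhs \<alpha> (\<beta> l) (\<gamma> l)"
      using lin_rhs_bound \<alpha> \<beta>\<gamma> P Q cov by blast
    moreover have "ln ?P = (\<Sum>j=1..n1. ln (p i j) * real (y j))"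
      "ln ?Q = (\<Sum>k=1..n2. ln (q i k) * real (z k))"
      using p q i by (intro ln_prod_power; auto)+
    ultimately show ?thesis by simp
  qed
  then show "(y, z) \<in> GUTLCSCP_LA_feasible m n1 n2 \<alpha> L \<beta> \<gamma> p q"
    using X by (simp add: GUTLCSCP_feasible_def GUTLCSCP_LA_feasible_def)
qed

text \<open>With the dual variables, each \<open>rc_lhs\<close> is at most the logarithm of the
  worst case. The cuts have nonnegative coefficients, so their validity for these logarithms carries
  over.\<close>

lemma RUTLCSCP_feasible_imp_LA_RC:
  assumes \<alpha>: "0 < \<alpha>" "\<alpha> < 1"
    and \<beta>\<gamma>: "\<And>l. l \<in> {1..L} \<Longrightarrow> 0 \<le> \<beta> l \<and> 0 < \<gamma> l \<and> \<beta> l + \<gamma> l = 1"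
    and p: "\<forall>i\<in>{1..m}. \<forall>j\<in>{1..n1}. 0 < p i j \<and> 0 \<le> dp i j \<and> p i j + dp i j \<le> 1"
    and q: "\<forall>i\<in>{1..m}. \<forall>k\<in>{1..n2}. 0 < q i k \<and> 0 \<le> dq i k \<and> q i k + dq i k \<le> 1"
    and X: "(y, z) \<in> RUTLCSCP_feasible m n1 n2 \<alpha> p dp q dq \<Gamma>"
  shows "\<exists>\<zeta>1 \<zeta>2 \<eta>1 \<eta>2.
    (y, z, \<zeta>1, \<zeta>2, \<eta>1, \<eta>2) \<in> RUTLCSCP_LA_RC_feasible m n1 n2 \<alpha> L \<beta> \<gamma> p dp q dq \<Gamma>"
proof -
  have y: "y \<in> binvecs n1" and z: "z \<in> binvecs n2"
    using X by (simp_all add: RUTLCSCP_feasible_def)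
  obtain \<zeta>1 \<eta>1 where 1: "\<zeta>1 \<in> {1..m} \<rightarrow>\<^sub>E {1..n1} \<rightarrow>\<^sub>E {0..}" "\<eta>1 \<in> {1..m} \<rightarrow>\<^sub>E {0..}"
    "\<forall>i\<in>{1..m}. rc_lhs n1 p \<Gamma> y \<zeta>1 \<eta>1 i \<le> ln (worst_case n1 p dp \<Gamma> y i) \<and>
      (\<forall>j\<in>{1..n1}. \<zeta>1 i j + \<eta>1 i \<ge> (ln (p i j + dp i j) - ln (p i j)) * real (y j))"
    using ex_rc_variables[where m = m and a = p and d = dp and \<Gamma> = \<Gamma>, OF y] p
    by (elim exE conjE meta_impE) simp_all
  obtain \<zeta>2 \<eta>2 where 2: "\<zeta>2 \<in> {1..m} \<rightarrow>\<^sub>E {1..n2} \<rightarrow>\<^sub>E {0..}" "\<eta>2 \<in> {1..m} \<rightarrow>\<^sub>E {0..}"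
    "\<forall>i\<in>{1..m}. rc_lhs n2 q \<Gamma> z \<zeta>2 \<eta>2 i \<le> ln (worst_case n2 q dq \<Gamma> z i) \<and>
      (\<forall>k\<in>{1..n2}. \<zeta>2 i k + \<eta>2 i \<ge> (ln (q i k + dq i k) - ln (q i k)) * real (z k))"
    using ex_rc_variables[where m = m and a = q and d = dq and \<Gamma> = \<Gamma>, OF z] q
    by (elim exE conjE meta_impE) simp_all
  have "rc_lhs n1 p \<Gamma> y \<zeta>1 \<eta>1 i \<le> ln (1 - \<alpha>) \<and> rc_lhs n2 q \<Gamma> z \<zeta>2 \<eta>2 i \<le> ln (1 - \<alpha>) \<and>
      (\<forall>l\<in>{1..L}. \<beta> l * rc_lhs n1 p \<Gamma> y \<zeta>1 \<eta>1 i + \<gamma> l * rc_lhs n2 q \<Gamma> z \<zeta>2 \<eta>2 i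
        \<le> lin_rhs \<alpha> (\<beta> l) (\<gamma> l))"
    if i: "i \<in> {1..m}" for i
  proof -
    let ?P = "worst_case n1 p dp \<Gamma> y i" and ?Q = "worst_case n2 q dq \<Gamma> z i"
    have P: "0 < ?P" "?P \<le> 1"
      using p i by (auto intro!: worst_case_pos[OF y] worst_case_le_1[OF y])
    have Q: "0 < ?Q" "?Q \<le> 1"
      using q i by (auto intro!: worst_case_pos[OF z] worst_case_le_1[OF z])
    have cov: "\<alpha> \<le> (1 - ?P) * (1 - ?Q)"
      using X i by (simp add: RUTLCSCP_feasible_def)
    then have "?Q \<le> 1 - \<alpha>" "?P \<le> 1 - \<alpha>"
      using P Q coverage_le[of ?P ?Q \<alpha>] coverage_le[of ?Q ?P \<alpha>] by (simp_all add: mult.commute)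
    then have "ln ?P \<le> ln (1 - \<alpha>)" "ln ?Q \<le> ln (1 - \<alpha>)"
      using P Q by simp_all
    moreover have lhs: "rc_lhs n1 p \<Gamma> y \<zeta>1 \<eta>1 i \<le> ln ?P" "rc_lhs n2 q \<Gamma> z \<zeta>2 \<eta>2 i \<le> ln ?Q"
      using 1 2 i by simp_all
    moreover have "\<beta> l * rc_lhs n1 p \<Gamma> y \<zeta>1 \<eta>1 i + \<gamma> l * rc_lhs n2 q \<Gamma> z \<zeta>2 \<eta>2 i
        \<le> lin_rhs \<alpha> (\<beta> l) (\<gamma> l)" if "l \<in> {1..L}" for l
    proof -
      have "\<beta> l * rc_lhs n1 p \<Gamma> y \<zeta>1 \<eta>1 i + \<gamma> l * rc_lhs n2 q \<Gamma> z \<zeta>2 \<eta>2 i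
          \<le> \<beta> l * ln ?P + \<gamma> l * ln ?Q"
        using \<beta>\<gamma>[OF that] lhs by (intro add_mono mult_left_mono) auto
      also have "\<dots> \<le> lin_rhs \<alpha> (\<beta> l) (\<gamma> l)"
        using lin_rhs_bound \<alpha> \<beta>\<gamma>[OF that] P Q cov by blast
      finally show ?thesis .
    qed
    ultimately show ?thesis by fastforce
  qed
  then have "(y, z, \<zeta>1, \<zeta>2, \<eta>1, \<eta>2) \<in> RUTLCSCP_LA_RC_feasible m n1 n2 \<alpha> L \<beta> \<gamma> p dp q dq \<Gamma>"
    using y z 1 2 by (simp add: RUTLCSCP_LA_RC_feasible_def)
  then show ?thesis by blast
qed

section \<open>Comparison of optimal values\<close>

text \<open>The two problems may have different variable spaces, linked by a cost-preserving lift of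
  feasible points. If \<open>b'\<close> is feasible with the relaxed optimal cost, then
  \<open>f a \<le> f b' = g b \<le> f a\<close>.\<close>

lemma is_arg_min_relaxation:
  fixes f :: "'a \<Rightarrow> 'c :: linorder"
  assumes "is_arg_min g Q b" "is_arg_min f P a"
    and "\<And>x. P x \<Longrightarrow> \<exists>x'. Q x' \<and> g x' = f x"
  shows "g b \<le> f a" and "P b' \<Longrightarrow> f b' = g b \<Longrightarrow> g b = f a"
proof -
  show le: "g b \<le> f a"
    using assms unfolding is_arg_min_linorder by metis
  show "g b = f a" if "P b'" "f b' = g b"
    using assms(2) le that unfolding is_arg_min_linorder by (metis antisym)
qed

theorem proposition1:
  fixes m n1 n2 L :: nat
    and c1 c2 \<beta> \<gamma> :: "nat \<Rightarrow> real"
    and \<alpha> :: real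
  assumes "0 < \<alpha>" "\<alpha> < 1"
    and "\<And>l. l \<in> {1..L} \<Longrightarrow> 0 \<le> \<beta> l \<and> \<beta> l < 1 \<and> 0 < \<gamma> l \<and> \<gamma> l \<le> 1 \<and> \<beta> l + \<gamma> l = 1"
  shows
    "(\<forall>(p :: nat \<Rightarrow> nat \<Rightarrow> real) (q :: nat \<Rightarrow> nat \<Rightarrow> real) yLA zLA y z.
        (\<forall>i\<in>{1..m}. \<forall>j\<in>{1..n1}. 0 < p i j \<and> p i j \<le> 1) \<longrightarrow>
        (\<forall>i\<in>{1..m}. \<forall>k\<in>{1..n2}. 0 < q i k \<and> q i k \<le> 1) \<longrightarrow>
        is_arg_min (\<lambda>(y, z). cost n1 n2 c1 c2 y z)
          (\<lambda>X. X \<in> GUTLCSCP_LA_feasible m n1 n2 \<alpha> L \<beta> \<gamma> p q) (yLA, zLA) \<longrightarrow>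
        is_arg_min (\<lambda>(y, z). cost n1 n2 c1 c2 y z)
          (\<lambda>X. X \<in> GUTLCSCP_feasible m n1 n2 \<alpha> p q) (y, z) \<longrightarrow>
        cost n1 n2 c1 c2 yLA zLA \<le> cost n1 n2 c1 c2 y z \<and>
        ((yLA, zLA) \<in> GUTLCSCP_feasible m n1 n2 \<alpha> p q \<longrightarrow>
           cost n1 n2 c1 c2 yLA zLA = cost n1 n2 c1 c2 y z))
     \<and>
     (\<forall>(p :: nat \<Rightarrow> nat \<Rightarrow> real) (dp :: nat \<Rightarrow> nat \<Rightarrow> real)
        (q :: nat \<Rightarrow> nat \<Rightarrow> real) (dq :: nat \<Rightarrow> nat \<Rightarrow> real) (\<Gamma> :: nat \<Rightarrow> nat)
        yLA zLA \<zeta>1 \<zeta>2 \<eta>1 \<eta>2 y z.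
        (\<forall>i\<in>{1..m}. \<forall>j\<in>{1..n1}. 0 < p i j \<and> 0 \<le> dp i j \<and> p i j + dp i j \<le> 1) \<longrightarrow>
        (\<forall>i\<in>{1..m}. \<forall>k\<in>{1..n2}. 0 < q i k \<and> 0 \<le> dq i k \<and> q i k + dq i k \<le> 1) \<longrightarrow>
        is_arg_min (\<lambda>(y, z, \<zeta>1, \<zeta>2, \<eta>1, \<eta>2). cost n1 n2 c1 c2 y z)
          (\<lambda>X. X \<in> RUTLCSCP_LA_RC_feasible m n1 n2 \<alpha> L \<beta> \<gamma> p dp q dq \<Gamma>)
          (yLA, zLA, \<zeta>1, \<zeta>2, \<eta>1, \<eta>2) \<longrightarrow>
        is_arg_min (\<lambda>(y, z). cost n1 n2 c1 c2 y z)
          (\<lambda>X. X \<in> RUTLCSCP_feasible m n1 n2 \<alpha> p dp q dq \<Gamma>) (y, z) \<longrightarrow>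
        cost n1 n2 c1 c2 yLA zLA \<le> cost n1 n2 c1 c2 y z \<and>
        ((yLA, zLA) \<in> RUTLCSCP_feasible m n1 n2 \<alpha> p dp q dq \<Gamma> \<longrightarrow>
           cost n1 n2 c1 c2 yLA zLA = cost n1 n2 c1 c2 y z))"
proof (intro conjI allI impI, goal_cases)
  case (1 p q yLA zLA y z)
  have "\<exists>X'. X' \<in> GUTLCSCP_LA_feasible m n1 n2 \<alpha> L \<beta> \<gamma> p q \<and>
      (\<lambda>(y, z). cost n1 n2 c1 c2 y z) X' = (\<lambda>(y, z). cost n1 n2 c1 c2 y z) X"
    if "X \<in> GUTLCSCP_feasible m n1 n2 \<alpha> p q" for X
    using GUTLCSCP_feasible_subset_LA[of \<alpha> L \<beta> \<gamma> m n1 p n2 q] assms 1(1,2) that by blast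
  from is_arg_min_relaxation(1)[OF 1(3,4) this] show ?case by simp
next
  case (2 p q yLA zLA y z)
  have "\<exists>X'. X' \<in> GUTLCSCP_LA_feasible m n1 n2 \<alpha> L \<beta> \<gamma> p q \<and>
      (\<lambda>(y, z). cost n1 n2 c1 c2 y z) X' = (\<lambda>(y, z). cost n1 n2 c1 c2 y z) X"
    if "X \<in> GUTLCSCP_feasible m n1 n2 \<alpha> p q" for X
    using GUTLCSCP_feasible_subset_LA[of \<alpha> L \<beta> \<gamma> m n1 p n2 q] assms 2(1,2) that by blast
  from is_arg_min_relaxation(2)[OF 2(3,4) this 2(5)] show ?case by simp
next
  case (3 p dp q dq \<Gamma> yLA zLA \<zeta>1 \<zeta>2 \<eta>1 \<eta>2 y z)
  \<comment> \<open>The lift appends \<zeta> and \<eta>, which carry no cost.\<close>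
  have "\<exists>X'. X' \<in> RUTLCSCP_LA_RC_feasible m n1 n2 \<alpha> L \<beta> \<gamma> p dp q dq \<Gamma> \<and>
      (\<lambda>(y, z, \<zeta>1, \<zeta>2, \<eta>1, \<eta>2). cost n1 n2 c1 c2 y z) X' = (\<lambda>(y, z). cost n1 n2 c1 c2 y z) X"
    if "X \<in> RUTLCSCP_feasible m n1 n2 \<alpha> p dp q dq \<Gamma>" for X
    using RUTLCSCP_feasible_imp_LA_RC[of \<alpha> L \<beta> \<gamma> m n1 p dp n2 q dq "fst X" "snd X" \<Gamma>]
      assms 3(1,2) that by (cases X) fastforce
  from is_arg_min_relaxation(1)[OF 3(3,4) this] show ?case by simp
next
  case (4 p dp q dq \<Gamma> yLA zLA \<zeta>1 \<zeta>2 \<eta>1 \<eta>2 y z)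
  have "\<exists>X'. X' \<in> RUTLCSCP_LA_RC_feasible m n1 n2 \<alpha> L \<beta> \<gamma> p dp q dq \<Gamma> \<and>
      (\<lambda>(y, z, \<zeta>1, \<zeta>2, \<eta>1, \<eta>2). cost n1 n2 c1 c2 y z) X' = (\<lambda>(y, z). cost n1 n2 c1 c2 y z) X"
    if "X \<in> RUTLCSCP_feasible m n1 n2 \<alpha> p dp q dq \<Gamma>" for X
    using RUTLCSCP_feasible_imp_LA_RC[of \<alpha> L \<beta> \<gamma> m n1 p dp n2 q dq "fst X" "snd X" \<Gamma>]
      assms 4(1,2) that by (cases X) fastforce
  \<comment> \<open>The point \<open>b'\<close> is the \<open>(yLA, zLA)\<close> part of the relaxed
    optimum.\<close>
  from is_arg_min_relaxation(2)[OF 4(3,4) this 4(5)] show ?case by simp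
qed

end
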